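(* Let $a_2,a_4,a_5,\Lambda\in\mathbb{C}$ with $\Lambda\neq-1$ and let $$V=\frac{1-\mathrm{i}}{3(\Lambda+1)}q_1^3+(q_2-\mathrm{i}q_3)\left[a_2q_1^2+a_4q_1(q_2-\mathrm{i}q_3)+a_5(q_2-\mathrm{i}q_3)^2+(1+\mathrm{i})q_1q_3\right].$$ Assume that $V$ has three simple proper Darboux points $[d_1],[d_2],[d_3]$ with spectra $(\Lambda_1^{(i)},\Lambda_2^{(i)})$, $i=1,2,3$, where, writing $a_1:=\frac{1-\mathrm{i}}{3(\Lambda+1)}$, $$[d_3]=\left[\frac{1}{3a_1}:\frac{a_2}{3a_1(3a_1-1+\mathrm{i})}:\frac{a_2}{3a_1(3\mathrm{i}a_1-1-\mathrm{i})}\right]$$ is the proper Darboux point whose spectrum is $(\Lambda,\Lambda)$. Then $$\sum_{i=1}^2\frac{1}{\Lambda_1^{(i)}\Lambda_2^{(i)}}=\frac{2\mathrm{i}+2(1-\mathrm{i})a_4}{a_2^2},$$ $$\sum_{i=1}^2\frac{\Lambda_1^{(i)}+\Lambda_2^{(i)}}{\Lambda_1^{(i)}\Lambda_2^{(i)}}=-\frac{2\left[a_2^2+(2\mathrm{i}+a_2^2+2(1-\mathrm{i})a_4)\Lambda\right]}{a_2^2(\Lambda+1)},$$ $$\sum_{i=1}^2\frac{(\Lambda_1^{(i)}+\Lambda_2^{(i)})^2}{\Lambda_1^{(i)}\Lambda_2^{(i)}}=\frac{8\Lambda\left[a_2^2+(\mathrm{i}+a_2^2+(1-\mathrm{i}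)a_4)\Lambda\right]}{a_2^2(1+\Lambda)^2}.$$
   Context: For a homogeneous cubic $V\in\mathbb{C}[q_1,q_2,q_3]$, with $V'=\operatorname{grad}V$ and Hessian $V''$: a point $[d]\in\mathbb{CP}^2$ is a Darboux point of $V$ if $d\neq 0$ and $d\wedge V'(d)=0$; it is proper if $V'(d)\neq0$. For a proper Darboux point the representative $d$ is always chosen so that $V'(d)=d$. Then $d$ is an eigenvector of $V''(d)$ with (trivial) eigenvalue $2$; if $\lambda_1,\lambda_2,2$ are the eigenvalues of $V''(d)$ counted with multiplicity, the spectrum of $[d]$ is the unordered pair $(\Lambda_1,\Lambda_2)=(\lambda_1-1,\lambda_2-1)$. A Darboux point is simple if it is an isolated point of multiplicity one of the projective algebraic set defined by the polynomials $q_i\partial V/\partial q_j-q_j\partial V/\partial q_i$; for a proper Darboux point this is equivalent to $\Lambda_1\Lambda_2\neq0$. (A potential of the stated form has at most three proper Darboux points; if it has three, then $a_2\neq 0$.) *)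

theory Defs
  imports "HOL-Analysis.Analysis" "HOL-Computational_Algebra.Computational_Algebra"
begin

text \<open>
  A polynomial in \<open>\<complex>[q\<^sub>1,q\<^sub>2,q\<^sub>3]\<close> is identified with the function it induces on
  \<open>complex^3\<close>; since the field is infinite, this loses nothing.
\<close>

inductive_set poly_fun :: "(complex^3 \<Rightarrow> complex) set" where
  const: "(\<lambda>q. c) \<in> poly_fun"
| coord: "(\<lambda>q. q $ k) \<in> poly_fun"
| add: "f \<in> poly_fun \<Longrightarrow> g \<in> poly_fun \<Longrightarrow> (\<lambda>q. f q + g q) \<in> poly_fun"
| mult: "f \<in> poly_fun \<Longrightarrow> g \<in> poly_fun \<Longrightarrow> (\<lambda>q. f q * g q) \<in> poly_fun"

definition partial_deriv :: "3 \<Rightarrow> (complex^3 \<Rightarrow> complex) \<Rightarrow> complex^3 \<Rightarrow> complex" where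
  "partial_deriv k V q = deriv (\<lambda>t. V (q + axis k t)) 0"

definition grad :: "(complex^3 \<Rightarrow> complex) \<Rightarrow> complex^3 \<Rightarrow> complex^3" where
  "grad V q = (\<chi> k. partial_deriv k V q)"

definition hessian :: "(complex^3 \<Rightarrow> complex) \<Rightarrow> complex^3 \<Rightarrow> complex^3^3" where
  "hessian V q = (\<chi> i j. partial_deriv i (partial_deriv j V) q)"

definition charpoly :: "complex^3^3 \<Rightarrow> complex poly" where
  "charpoly A = det (mat [:0, 1:] - map_matrix (\<lambda>a. [:a:]) A)"

text \<open>The point \<open>[d]\<close> of the projective plane, for \<open>d \<noteq> 0\<close>, as a punctured line.\<close>

definition proj_point :: "complex^3 \<Rightarrow> (complex^3) set" where
  "proj_point d = {c *s d | c. c \<noteq> 0}"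

text \<open>The components of \<open>q \<and> V'(q)\<close>.\<close>

definition darboux_poly :: "(complex^3 \<Rightarrow> complex) \<Rightarrow> 3 \<Rightarrow> 3 \<Rightarrow> complex^3 \<Rightarrow> complex" where
  "darboux_poly V i j q = q $ i * grad V q $ j - q $ j * grad V q $ i"

definition darboux_point :: "(complex^3 \<Rightarrow> complex) \<Rightarrow> complex^3 \<Rightarrow> bool" where
  "darboux_point V d \<longleftrightarrow> d \<noteq> 0 \<and> (\<forall>i j. darboux_poly V i j d = 0)"

definition proper_darboux_point :: "(complex^3 \<Rightarrow> complex) \<Rightarrow> complex^3 \<Rightarrow> bool" where
  "proper_darboux_point V d \<longleftrightarrow> darboux_point V d \<and> grad V d \<noteq> 0"

text \<open>
  The spectrum of \<open>[d]\<close>, an unordered pair encoded as a multiset.  It is meaningful only for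
  the representative with \<open>grad V d = d\<close>, for which 2 is an eigenvalue of the Hessian; only
  one copy of that eigenvalue is discarded.
\<close>

definition spectrum :: "(complex^3 \<Rightarrow> complex) \<Rightarrow> complex^3 \<Rightarrow> complex multiset" where
  "spectrum V d = image_mset (\<lambda>l. l - 1) (proots (charpoly (hessian V d)) - {#2#})"

text \<open>The ideal of \<open>poly_fun\<close> generated by a finite set \<open>G\<close>.\<close>

definition poly_ideal :: "(complex^3 \<Rightarrow> complex) set \<Rightarrow> (complex^3 \<Rightarrow> complex) set" where
  "poly_ideal G = {f. \<exists>h. (\<forall>g\<in>G. h g \<in> poly_fun) \<and> f = (\<lambda>q. \<Sum>g\<in>G. h g q * g q)}"

text \<open>
  The contraction to \<open>poly_fun\<close> of the extension of the ideal \<open>J\<close> to the local ring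
  \<open>\<O>\<^sub>p\<close> of affine 3-space at \<open>p\<close>.
\<close>

definition local_contraction ::
    "(complex^3 \<Rightarrow> complex) set \<Rightarrow> complex^3 \<Rightarrow> (complex^3 \<Rightarrow> complex) set" where
  "local_contraction J p =
     {f \<in> poly_fun. \<exists>s\<in>poly_fun. s p \<noteq> 0 \<and> (\<lambda>q. s q * f q) \<in> J}"

text \<open>
  The multiplicity at \<open>p\<close> of the scheme cut out by \<open>J\<close> is the complex dimension of
  \<open>\<O>\<^sub>p / J \<O>\<^sub>p\<close>.  The ring \<open>poly_fun\<close> modulo the contraction of \<open>J \<O>\<^sub>p\<close>
  embeds in this quotient, and is all of it as soon as one of the two is finite-dimensional.
  The definition says that \<open>b 0, \<dots>, b (n - 1)\<close> represent a basis of that quotient.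
\<close>

definition has_multiplicity ::
    "(complex^3 \<Rightarrow> complex) set \<Rightarrow> complex^3 \<Rightarrow> nat \<Rightarrow> bool" where
  "has_multiplicity J p n \<longleftrightarrow>
     (\<exists>b. (\<forall>m<n. b m \<in> poly_fun) \<and>
          (\<forall>f\<in>poly_fun. \<exists>!c :: nat \<Rightarrow> complex. c \<in> {..<n} \<rightarrow>\<^sub>E UNIV \<and>
             (\<lambda>q. f q - (\<Sum>m<n. c m * b m q)) \<in> local_contraction J p))"

text \<open>
  The affine chart of the projective plane in which coordinate \<open>k\<close> does not vanish is
  identified with the affine plane \<open>q\<^sub>k = d\<^sub>k\<close>, which contains the representative \<open>d\<close>.
  The next ideal defines in 3-space the part of the projective Darboux scheme lying in this chart.
\<close>

definition darboux_chart_ideal ::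
    "(complex^3 \<Rightarrow> complex) \<Rightarrow> 3 \<Rightarrow> complex^3 \<Rightarrow> (complex^3 \<Rightarrow> complex) set" where
  "darboux_chart_ideal V k d =
     poly_ideal (insert (\<lambda>q. q $ k - d $ k) {darboux_poly V i j | i j. True})"

text \<open>
  Isolatedness and multiplicity in the projective plane are local, hence may be read off in any
  chart containing \<open>[d]\<close>; the result does not depend on the chart.
\<close>

definition simple_darboux_point :: "(complex^3 \<Rightarrow> complex) \<Rightarrow> complex^3 \<Rightarrow> bool" where
  "simple_darboux_point V d \<longleftrightarrow> darboux_point V d \<and>
     (\<exists>k. d $ k \<noteq> 0 \<and>
          d isolated_in {e. darboux_point V e \<and> e $ k = d $ k} \<and>
          has_multiplicity (darboux_chart_ideal V k d) d 1)"

end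

theory Submission
  imports Defs
begin

text \<open>
  Put \<open>z = q\<^sub>2 - \<i> q\<^sub>3\<close>.  A nonzero solution of \<open>V'(q) = q\<close> either lies in the plane \<open>z = 0\<close>, and
  then it is \<open>d\<^sub>3\<close> as soon as \<open>\<Lambda> \<noteq> 0\<close>, or it satisfies \<open>q\<^sub>1 = (1 + \<i>)/2\<close> and is determined by \<open>z\<close>,
  which is a root of \<open>Q = 3 a\<^sub>5 z\<^sup>2 + ((1 + \<i>) a\<^sub>4 - 1) z + \<i> a\<^sub>2 / 2\<close>.  (If \<open>\<Lambda> = 0\<close>, then \<open>a\<^sub>2 = 0\<close>
  and every point \<open>(q\<^sub>1, \<i> t, t)\<close> is a Darboux point, so \<open>d\<^sub>3\<close> is not isolated.)  Hence \<open>d\<^sub>1\<close> and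
  \<open>d\<^sub>2\<close> correspond to two distinct nonzero roots of \<open>Q\<close>.  As the Hessian there has the eigenvalue 2,
  its trace and \<open>det (V'' - 1)\<close> give \<open>\<Lambda>\<^sub>1 + \<Lambda>\<^sub>2 = 2 a\<^sub>2 z - 2 \<Lambda> / (\<Lambda> + 1)\<close> and
  \<open>\<Lambda>\<^sub>1 \<Lambda>\<^sub>2 = -2 \<i> z\<^sup>2 Q'(z)\<close>, so everything reduces to the sums of \<open>z\<^sup>k / (z\<^sup>2 Q'(z))\<close>,
  \<open>k = 0, 1, 2\<close>, over the roots of \<open>Q\<close>.
\<close>

unbundle no Formal_Power_Series.fps_syntax

lemma vec3_eq_iff: "a = b \<longleftrightarrow> a$1 = b$1 \<and> a$2 = b$2 \<and> a$3 = b$3" for a b :: "'a^3"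
  by (simp add: vec_eq_iff forall_3)

section \<open>Gradient and Hessian of the potential\<close>

lemma partial_deriv_eqI:
  "((\<lambda>t. V (q + axis k t)) has_field_derivative D) (at 0) \<Longrightarrow> partial_deriv k V q = D"
  unfolding partial_deriv_def by (rule DERIV_imp_deriv)

definition potential :: "complex \<Rightarrow> complex \<Rightarrow> complex \<Rightarrow> complex \<Rightarrow> complex^3 \<Rightarrow> complex" where
  "potential a1 a2 a4 a5 q = a1 * (q$1)^3
     + (q$2 - \<i> * q$3) *
       (a2 * (q$1)^2 + a4 * q$1 * (q$2 - \<i> * q$3) + a5 * (q$2 - \<i> * q$3)^2
        + (1 + \<i>) * q$1 * q$3)"

lemma partial_deriv_potential:
  "partial_deriv 1 (potential a1 a2 a4 a5) = (\<lambda>q. 3 * a1 * (q$1)^2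
     + (q$2 - \<i> * q$3) * (2 * a2 * q$1 + a4 * (q$2 - \<i> * q$3) + (1 + \<i>) * q$3))"
  "partial_deriv 2 (potential a1 a2 a4 a5) = (\<lambda>q. a2 * (q$1)^2
     + 2 * a4 * q$1 * (q$2 - \<i> * q$3) + 3 * a5 * (q$2 - \<i> * q$3)^2 + (1 + \<i>) * q$1 * q$3)"
  "partial_deriv 3 (potential a1 a2 a4 a5) = (\<lambda>q. - \<i> * (a2 * (q$1)^2
     + 2 * a4 * q$1 * (q$2 - \<i> * q$3) + 3 * a5 * (q$2 - \<i> * q$3)^2 + (1 + \<i>) * q$1 * q$3)
     + (1 + \<i>) * q$1 * (q$2 - \<i> * q$3))"
  unfolding potential_def fun_eq_iff
  by (intro allI partial_deriv_eqI;
      auto simp: axis_def intro!: derivative_eq_intros; algebra)+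

lemma hessian_potential:
  fixes a1 a2 a4 a5 :: complex and q :: "complex^3"
  defines "H \<equiv> hessian (potential a1 a2 a4 a5) q"
    and "h \<equiv> 2 * a2 * q$1 + 2 * a4 * (q$2 - \<i> * q$3) + (1 + \<i>) * q$3"
    and "e \<equiv> 2 * a4 * q$1 + 6 * a5 * (q$2 - \<i> * q$3)"
  shows "H$1$1 = 6 * a1 * q$1 + 2 * a2 * (q$2 - \<i> * q$3)"
    "H$1$2 = h" "H$1$3 = - \<i> * h + (1 + \<i>) * (q$2 - \<i> * q$3)"
    "H$2$1 = h" "H$2$2 = e" "H$2$3 = - \<i> * e + (1 + \<i>) * q$1"
    "H$3$1 = - \<i> * h + (1 + \<i>) * (q$2 - \<i> * q$3)" "H$3$2 = - \<i> * e + (1 + \<i>) * q$1"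
    "H$3$3 = - e + (2 - 2 * \<i>) * q$1"
  unfolding H_def h_def e_def hessian_def vec_lambda_beta partial_deriv_potential
  by (rule partial_deriv_eqI;
      auto simp: axis_def algebra_simps intro!: derivative_eq_intros)+

section \<open>Spectra read off from trace and determinant\<close>

lemma charpoly_3:
  "charpoly A = [:- det A,
     A$1$1 * A$2$2 - A$1$2 * A$2$1 + (A$1$1 * A$3$3 - A$1$3 * A$3$1)
       + (A$2$2 * A$3$3 - A$2$3 * A$3$2),
     - (A$1$1 + A$2$2 + A$3$3), 1:]"
  by (simp add: charpoly_def det_3 mat_def map_matrix_def algebra_simps)

lemma poly_charpoly: "poly (charpoly A) t = det (mat t - A)"
  by (simp add: charpoly_3 det_3 mat_def algebra_simps power3_eq_cube)

text \<open>The eigenvector \<open>v\<close> makes 2 a root of the characteristic polynomial, which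
  is therefore \<open>(X - 2) (X - (l + 1)) (X - (m + 1))\<close>. Its coefficient at
  \<open>X^2\<close> gives the trace and its value at 1 the determinant.\<close>

lemma spectrum_pairD:
  fixes V :: "complex^3 \<Rightarrow> complex" and q v :: "complex^3"
  defines "H \<equiv> hessian V q"
  assumes eig: "H *v v = 2 *s v" and v: "v \<noteq> 0" and spec: "spectrum V q = {#l, m#}"
  shows "trace H = l + m + 4" and "det (H - mat 1) = l * m"
proof -
  have "(mat 2 - H) *v v = 0"
    using eig by (simp add: matrix_vector_mult_def mat_def vec3_eq_iff sum_3 algebra_simps)
  with v have "det (mat 2 - H) = 0"
    by (metis invertible_det_nz invertible_left_inverse matrix_left_invertible_ker)
  then have root: "poly (charpoly H) 2 = 0"
    by (simp add: poly_charpoly)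
  have nz: "charpoly H \<noteq> 0"
    by (simp add: charpoly_3)
  have "image_mset (\<lambda>l. l + 1) (spectrum V q) = proots (charpoly H) - {#2#}"
    by (simp add: spectrum_def H_def multiset.map_comp o_def)
  then have "proots (charpoly H) - {#2#} = {#l + 1, m + 1#}"
    by (simp add: spec)
  \<comment> \<open>Without this, \<open>- {#2#}\<close> could have removed nothing.\<close>
  moreover have "2 \<in># proots (charpoly H)"
    using root nz by simp
  ultimately have "proots (charpoly H) = {#2, l + 1, m + 1#}"
    by (metis insert_DiffM)
  moreover have "lead_coeff (charpoly H) = 1"
    by (simp add: charpoly_3)
  ultimately have eq: "charpoly H = [:-2, 1:] * ([:- (l + 1), 1:] * [:- (m + 1), 1:])"
    using complex_poly_decompose_multiset[of "charpoly H"] by simp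
  have "coeff (charpoly H) 2 = - (l + m + 4)"
    unfolding eq by (simp add: numeral_2_eq_2)
  then show "trace H = l + m + 4"
    by (simp add: charpoly_3 trace_def sum_3 numeral_2_eq_2 algebra_simps)
  have "det (mat 1 - H) = - (l * m)"
    unfolding poly_charpoly[symmetric] eq by (simp add: algebra_simps)
  then show "det (H - mat 1) = l * m"
    by (simp add: det_3 mat_def algebra_simps)
qed

text \<open>Euler's identity for the gradient, homogeneous of degree 2. Where
  \<open>grad V q = q\<close>, it makes \<open>q\<close> an eigenvector of the Hessian with
  eigenvalue 2.\<close>

lemma hessian_potential_euler:
  "hessian (potential a1 a2 a4 a5) q *v q = 2 *s grad (potential a1 a2 a4 a5) q"
  by (simp add: vec3_eq_iff matrix_vector_mult_def sum_3 hessian_potential grad_def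
      partial_deriv_potential) (intro conjI; simp add: algebra_simps power2_eq_square)

section \<open>Solutions of \<open>grad V q = q\<close>, on and off the plane z = 0\<close>

lemma grad_potential_fixed:
  fixes a1 a2 a4 a5 :: complex and q :: "complex^3"
  assumes fixp: "grad (potential a1 a2 a4 a5) q = q"
  defines "z \<equiv> q$2 - \<i> * q$3"
  shows "3 * a1 * (q$1)^2 + z * (2 * a2 * q$1 + a4 * z + (1 + \<i>) * q$3) = q$1"
    and "a2 * (q$1)^2 + 2 * a4 * q$1 * z + 3 * a5 * z^2 + (1 + \<i>) * q$1 * q$3 = q$2"
    and "z = (1 - \<i>) * q$1 * z"
proof -
  have 1: "grad (potential a1 a2 a4 a5) q $ 1 = q$1"
    and 2: "grad (potential a1 a2 a4 a5) q $ 2 = q$2"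
    and 3: "grad (potential a1 a2 a4 a5) q $ 3 = q$3"
    by (simp_all only: fixp)
  show "3 * a1 * (q$1)^2 + z * (2 * a2 * q$1 + a4 * z + (1 + \<i>) * q$3) = q$1"
    using 1 by (simp add: grad_def partial_deriv_potential z_def)
  show g2: "a2 * (q$1)^2 + 2 * a4 * q$1 * z + 3 * a5 * z^2 + (1 + \<i>) * q$1 * q$3 = q$2"
    using 2 by (simp add: grad_def partial_deriv_potential z_def)
  \<comment> \<open>The third partial derivative is \<open>- \<i>\<close> times the second plus a
    multiple of \<open>q$1 * z\<close>, so the second drops out of \<open>q$2 - \<i> * q$3\<close>.
    The result splits into the cases \<open>z = 0\<close> and
    \<open>(1 - \<i>) * q$1 = 1\<close>.\<close>
  have g3: "- \<i> * q$2 + (1 + \<i>) * q$1 * z = q$3"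
    using 3 g2 by (simp add: grad_def partial_deriv_potential z_def)
  have "\<i> * q$3 = q$2 + (\<i> - 1) * q$1 * z"
    unfolding g3[symmetric] by (simp add: algebra_simps)
  then show "z = (1 - \<i>) * q$1 * z"
    by (simp add: z_def algebra_simps)
qed

lemma half_one_plus_i_iff: "(1 - \<i>) * x = c \<longleftrightarrow> x = (1 + \<i>) / 2 * c"
proof -
  have "(1 - \<i>) * ((1 + \<i>) / 2) = 1"
    by (simp add: complex_eq_iff)
  then have "(1 - \<i>) * ((1 + \<i>) / 2 * y) = y" "(1 + \<i>) / 2 * ((1 - \<i>) * y) = y" for y
    by (simp_all only: mult.assoc[symmetric] mult.commute[of "(1 + \<i>) / 2" "1 - \<i>"] mult_1)
  then show ?thesis
    by metis
qed

text \<open>At this value of \<open>q$1\<close> the mixed term of the second equation is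
  \<open>\<i> * q$3\<close>; moved to the right it completes \<open>z\<close> and leaves a quadratic
  in \<open>z\<close>. The first equation is then linear in \<open>q$3\<close> with nonzero
  coefficient, so \<open>z\<close> determines \<open>q\<close>.\<close>

lemma grad_potential_fixed_off_plane:
  fixes a1 a2 a4 a5 :: complex and q :: "complex^3"
  assumes fixp: "grad (potential a1 a2 a4 a5) q = q"
  defines "z \<equiv> q$2 - \<i> * q$3"
  assumes z: "z \<noteq> 0"
  shows "q$1 = (1 + \<i>) / 2"
    and "3 * a5 * z^2 + ((1 + \<i>) * a4 - 1) * z + \<i> / 2 * a2 = 0"
    and "(1 + \<i>) * z * q$3 = (1 + \<i>) / 2 - 3 * a1 * \<i> / 2 - (1 + \<i>) * a2 * z - a4 * z^2"
proof -
  note eqs = grad_potential_fixed[OF fixp, folded z_def]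
  show x: "q$1 = (1 + \<i>) / 2"
    using eqs(3) z half_one_plus_i_iff[of "q$1" 1] by simp
  have sq: "((1 + \<i>) / 2)^2 = \<i> / 2"
    by (simp add: power2_eq_square field_simps)
  have x3: "(1 + \<i>) * ((1 + \<i>) / 2) = \<i>"
    by (simp add: field_simps)
  show "3 * a5 * z^2 + ((1 + \<i>) * a4 - 1) * z + \<i> / 2 * a2 = 0"
    using eqs(2) unfolding x sq x3 by (simp add: z_def field_simps)
  show "(1 + \<i>) * z * q$3 = (1 + \<i>) / 2 - 3 * a1 * \<i> / 2 - (1 + \<i>) * a2 * z - a4 * z^2"
    using eqs(1) unfolding x sq by (simp add: field_simps power2_eq_square)
qed

lemma cubic_coefficient:
  fixes a1 \<Lambda> :: complex
  assumes "\<Lambda> \<noteq> -1" and a1: "a1 = (1 - \<i>) / (3 * (\<Lambda> + 1))"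
  shows "3 * a1 * (\<Lambda> + 1) = 1 - \<i>"
proof -
  have "3 * (\<Lambda> + 1) \<noteq> 0"
    using assms(1) by (metis add_eq_0_iff2 mult_eq_0_iff zero_neq_numeral)
  then have "a1 * (3 * (\<Lambda> + 1)) = 1 - \<i>"
    using a1 nonzero_eq_divide_eq by blast
  then show ?thesis
    by (simp add: mult_ac)
qed

text \<open>If \<open>q$1\<close> were 0, the second equation would force \<open>q = 0\<close>;
  hence \<open>3 * a1 * q$1 = 1\<close>. The second equation then determines \<open>q$3\<close> as
  long as \<Lambda> is nonzero.\<close>

lemma grad_potential_fixed_on_plane:
  fixes a1 a2 a4 a5 \<Lambda> :: complex and q :: "complex^3"
  assumes fixp: "grad (potential a1 a2 a4 a5) q = q" and q: "q \<noteq> 0"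
    and z: "q$2 = \<i> * q$3" and \<Lambda>: "\<Lambda> \<noteq> -1" and a1: "a1 = (1 - \<i>) / (3 * (\<Lambda> + 1))"
  shows "q$1 = (1 + \<i>) / 2 * (\<Lambda> + 1)" and "- \<i> * \<Lambda> * q$3 = a2 * (q$1)^2"
proof -
  note eqs = grad_potential_fixed[OF fixp]
  have 1: "3 * a1 * (q$1)^2 = q$1"
    using eqs(1) z by simp
  have 2: "a2 * (q$1)^2 + (1 + \<i>) * q$1 * q$3 = \<i> * q$3"
    using eqs(2) z by simp
  have "q$1 \<noteq> 0"
    using 2 z q by (auto simp: vec3_eq_iff)
  with 1 have "3 * a1 * q$1 = 1"
    by (simp add: power2_eq_square flip: mult.assoc)
  then have "(1 - \<i>) * q$1 = \<Lambda> + 1"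
    using cubic_coefficient[OF \<Lambda> a1] by algebra
  then show x: "q$1 = (1 + \<i>) / 2 * (\<Lambda> + 1)"
    by (simp add: half_one_plus_i_iff)
  have "(1 + \<i>) * q$1 = \<i> * (\<Lambda> + 1)"
    unfolding x by (simp add: field_simps)
  with 2 show "- \<i> * \<Lambda> * q$3 = a2 * (q$1)^2"
    by algebra
qed

section \<open>Trace and determinant of the Hessian off the plane\<close>

lemma trace_hessian_potential_off_plane:
  assumes "q$1 = (1 + \<i>) / 2"
  shows "trace (hessian (potential a1 a2 a4 a5) q)
    = 3 * (1 + \<i>) * a1 + 2 * a2 * (q$2 - \<i> * q$3) + 2"
  by (simp add: trace_def sum_3 hessian_potential assms field_simps)

lemma det_hessian_potential_off_plane:
  fixes q :: "complex^3"
  assumes "q$1 = (1 + \<i>) / 2"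
  defines "z \<equiv> q$2 - \<i> * q$3"
  shows "det (hessian (potential a1 a2 a4 a5) q - mat 1)
    = -2 * \<i> * z^2 * (6 * a5 * z + (1 + \<i>) * a4 - 1)"
proof -
  define h where "h = 2 * a2 * q$1 + 2 * a4 * z + (1 + \<i>) * q$3"
  define e where "e = 2 * a4 * q$1 + 6 * a5 * z"
  have c: "(1 + \<i>) * q$1 = \<i>" "(2 - 2 * \<i>) * q$1 = 2"
    by (simp_all add: assms(1) field_simps)
  \<comment> \<open>The lower right 2 by 2 block is \<open>e - 1\<close> times the matrix with rows
    \<open>(1, - \<i>)\<close> and \<open>(- \<i>, -1)\<close>, which is singular, so the upper left
    entry drops out. With \<open>k\<close> for the (1,3) entry, what remains is
    \<open>- (e - 1) * (k + \<i> * h)^2\<close>, and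
    \<open>k + \<i> * h = (1 + \<i>) * z\<close>.\<close>
  have "det (hessian (potential a1 a2 a4 a5) q - mat 1) = -2 * \<i> * z^2 * (e - 1)"
    unfolding det_3
    by (simp add: mat_def hessian_potential c flip: z_def h_def e_def) (algebra add: power2_i)
  also have "e = (1 + \<i>) * a4 + 6 * a5 * z"
    by (simp add: e_def assms(1))
  finally show ?thesis
    by (simp add: algebra_simps)
qed

section \<open>Excluding \<Lambda> = 0 by a line of Darboux points\<close>

lemma not_simple_darboux_point_degenerate:
  fixes a1 a4 a5 :: complex and d :: "complex^3"
  defines "V \<equiv> potential a1 0 a4 a5"
  assumes "simple_darboux_point V d" and "grad V d = d"
    and "3 * a1 = 1 - \<i>" and "d$2 = 0" and "d$3 = 0"
  shows False
proof -
  have d1: "d$1 \<noteq> 0"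
    using assms by (auto simp: simple_darboux_point_def darboux_point_def vec3_eq_iff)
  define S where "S = {e. darboux_point V e \<and> e$1 = d$1}"
  \<comment> \<open>Only the first coordinate of \<open>d\<close> is nonzero, so the chart in the
    definition must be the first one.\<close>
  have "d isolated_in S"
    using assms(2,5,6) d1 unfolding simple_darboux_point_def S_def by (metis exhaust_3)
  then obtain \<epsilon> where "\<epsilon> > 0" and \<epsilon>: "\<And>e. e \<in> S \<Longrightarrow> dist d e < \<epsilon> \<Longrightarrow> e = d"
    unfolding isolated_in_dist_Ex_iff by auto
  \<comment> \<open>The point \<open>e\<close> lies on the line of Darboux points through
    \<open>d\<close>, at distance at most \<open>2 * \<epsilon> / 3\<close> from it.\<close>
  define t where "t = complex_of_real (\<epsilon> / 3)"
  define e :: "complex^3" where "e = vector [d$1, \<i> * t, t]"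
  have e: "e$1 = d$1" "e$2 = \<i> * t" "e$3 = t"
    by (simp_all add: e_def vector_3)
  have "(1 - \<i>) * (d$1)^2 = d$1"
    using grad_potential_fixed(1)[OF assms(3)[unfolded V_def]] assms(4-6) by simp
  then have x: "d$1 = (1 + \<i>) / 2"
    using d1 half_one_plus_i_iff[of "d$1" 1] by (simp add: power2_eq_square)
  have eq: "(1 - \<i>) * (d$1)^2 = d$1" "(1 + \<i>) * d$1 = \<i>"
    by (simp_all add: x field_simps power2_eq_square)
  have "grad V e = e"
    by (simp add: vec3_eq_iff grad_def V_def partial_deriv_potential e assms(4) eq)
  then have "e \<in> S"
    using d1 e by (auto simp: S_def darboux_point_def darboux_poly_def)
  moreover have "dist d e \<le> (\<Sum>i\<in>UNIV. dist (d$i) (e$i))"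
    unfolding dist_vec_def by (rule L2_set_le_sum) simp
  then have "dist d e < \<epsilon>"
    using \<open>\<epsilon> > 0\<close> by (simp add: sum_3 e assms(5,6) t_def norm_mult)
  ultimately have "e = d"
    by (rule \<epsilon>)
  then have "t = 0"
    using e(3) assms(6) by simp
  then show False
    using \<open>\<epsilon> > 0\<close> by (simp add: t_def)
qed

section \<open>Power sums over the roots of a quadratic\<close>

text \<open>
  If \<open>p = 0\<close>, the polynomial vanishes identically and both sides are 0 because \<open>x / 0 = 0\<close>.
\<close>

lemma quadratic_roots_power_sums:
  fixes p r s z1 z2 :: complex
  assumes "z1 \<noteq> z2" "z1 \<noteq> 0" "z2 \<noteq> 0"
    and "p * z1^2 + r * z1 + s = 0" "p * z2^2 + r * z2 + s = 0"
  defines "P \<equiv> \<lambda>z. z^2 * (2 * p * z + r)"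
  shows "1 / P z1 + 1 / P z2 = r / s^2"
    and "z1 / P z1 + z2 / P z2 = - (1 / s)"
    and "z1^2 / P z1 + z2^2 / P z2 = 0"
proof -
  \<comment> \<open>Vieta's formulas for \<open>r\<close> and \<open>s\<close>; they turn the
    derivative at a root into \<open>p\<close> times the difference of the roots, with opposite
    signs at the two roots.\<close>
  have "(z1 - z2) * (p * (z1 + z2) + r) = 0"
    using assms(4,5) by algebra
  then have r: "r = - p * (z1 + z2)"
    using assms(1) by (simp add: add_eq_0_iff)
  have s: "s = p * z1 * z2"
    using assms(4) r by algebra
  have P: "P z1 = p * z1^2 * (z1 - z2)" "P z2 = - (p * z2^2 * (z1 - z2))"
    unfolding P_def r by algebra+
  show "1 / P z1 + 1 / P z2 = r / s^2"
    unfolding P r s by (cases "p = 0"; simp add: assms(1-3) divide_simps power2_eq_square;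
      simp add: algebra_simps)
  show "z1 / P z1 + z2 / P z2 = - (1 / s)"
    unfolding P r s by (cases "p = 0"; simp add: assms(1-3) divide_simps power2_eq_square;
      simp add: algebra_simps)
  show "z1^2 / P z1 + z2^2 / P z2 = 0"
    unfolding P by (cases "p = 0"; simp add: assms(1-3) divide_simps)
qed

section \<open>The three sums over the Darboux points off the plane\<close>

theorem lemma4p8:
  fixes a1 a2 a4 a5 \<Lambda> :: complex
    and V :: "complex^3 \<Rightarrow> complex"
    and d :: "nat \<Rightarrow> complex^3"
    and \<Lambda>1 \<Lambda>2 :: "nat \<Rightarrow> complex"
  assumes \<Lambda>: "\<Lambda> \<noteq> -1"
    and a1: "a1 = (1 - \<i>) / (3 * (\<Lambda> + 1))"
    and V: "V = (\<lambda>q. (1 - \<i>) / (3 * (\<Lambda> + 1)) * (q$1)^3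
              + (q$2 - \<i> * q$3) *
                (a2 * (q$1)^2 + a4 * q$1 * (q$2 - \<i> * q$3) + a5 * (q$2 - \<i> * q$3)^2
                 + (1 + \<i>) * q$1 * q$3))"
    and proper: "\<And>i. i \<in> {1..3} \<Longrightarrow> proper_darboux_point V (d i)"
    and normalised: "\<And>i. i \<in> {1..3} \<Longrightarrow> grad V (d i) = d i"
    and simple: "\<And>i. i \<in> {1..3} \<Longrightarrow> simple_darboux_point V (d i)"
    and distinct_points: "inj_on (\<lambda>i. proj_point (d i)) {1..3}"
    and spectra: "\<And>i. i \<in> {1..3} \<Longrightarrow> spectrum V (d i) = {#\<Lambda>1 i, \<Lambda>2 i#}"
    and d3: "proj_point (d 3) = proj_point (vector
              [1 / (3 * a1),
               a2 / (3 * a1 * (3 * a1 - 1 + \<i>)),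
               a2 / (3 * a1 * (3 * \<i> * a1 - 1 - \<i>))])"
    and spectrum3: "spectrum V (d 3) = {#\<Lambda>, \<Lambda>#}"
  shows "(\<Sum>i=1..2. 1 / (\<Lambda>1 i * \<Lambda>2 i)) = (2 * \<i> + 2 * (1 - \<i>) * a4) / a2^2
    \<and> (\<Sum>i=1..2. (\<Lambda>1 i + \<Lambda>2 i) / (\<Lambda>1 i * \<Lambda>2 i))
        = - (2 * (a2^2 + (2 * \<i> + a2^2 + 2 * (1 - \<i>) * a4) * \<Lambda>) / (a2^2 * (\<Lambda> + 1)))
    \<and> (\<Sum>i=1..2. (\<Lambda>1 i + \<Lambda>2 i)^2 / (\<Lambda>1 i * \<Lambda>2 i))
        = 8 * \<Lambda> * (a2^2 + (\<i> + a2^2 + (1 - \<i>) * a4) * \<Lambda>) / (a2^2 * (1 + \<Lambda>)^2)"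
proof -
  have m: "1 \<in> {1..2::nat}" "2 \<in> {1..2::nat}"
    by simp_all
  have three: "3 \<in> {1..3::nat}"
    by simp
  define z where "z i = d i $ 2 - \<i> * d i $ 3" for i
  have \<Lambda>': "\<Lambda> + 1 \<noteq> 0"
    using \<Lambda> by (metis add_eq_0_iff2)
  have V': "V = potential a1 a2 a4 a5"
    by (simp add: V a1 potential_def fun_eq_iff)
  note norm' = normalised[unfolded V']
  have nz: "d i \<noteq> 0" if "i \<in> {1..3}" for i
    using proper[OF that] by (simp add: proper_darboux_point_def darboux_point_def)
  have distinct: "d i \<noteq> d j" if "i \<in> {1..3}" "j \<in> {1..3}" "i \<noteq> j" for i j
    using inj_onD[OF distinct_points, of i j] that by auto

  have "d 3 \<in> proj_point (d 3)"
    by (auto simp: proj_point_def intro!: exI[of _ 1])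
  then obtain c where c: "d 3 = c *s vector
              [1 / (3 * a1),
               a2 / (3 * a1 * (3 * a1 - 1 + \<i>)),
               a2 / (3 * a1 * (3 * \<i> * a1 - 1 - \<i>))]"
    unfolding d3 by (auto simp: proj_point_def)
  \<comment> \<open>The two denominators differ by the factor \<open>\<i>\<close>, which puts
    \<open>d 3\<close> on the plane z = 0 for every scale \<open>c\<close>.\<close>
  have "3 * \<i> * a1 - 1 - \<i> = \<i> * (3 * a1 - 1 + \<i>)"
    by (simp add: algebra_simps)
  then have plane3: "d 3 $ 2 = \<i> * d 3 $ 3"
    by (simp add: c)
  note on_plane = grad_potential_fixed_on_plane[OF norm' nz _ \<Lambda> a1]
  have \<Lambda>0: "\<Lambda> \<noteq> 0"
  proof
    assume "\<Lambda> = 0"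
    then have a1': "3 * a1 = 1 - \<i>"
      by (simp add: a1)
    have "d 3 $ 1 = (1 + \<i>) / 2" "a2 * (d 3 $ 1)^2 = 0"
      using on_plane[of 3] plane3 \<open>\<Lambda> = 0\<close> by simp_all
    moreover have "(1 + \<i>) / 2 \<noteq> 0"
      by (simp add: complex_eq_iff)
    ultimately have "a2 = 0"
      by (metis mult_eq_0_iff power_not_zero)
    then show False
      using not_simple_darboux_point_degenerate[OF simple[of 3, unfolded V' \<open>a2 = 0\<close>]
          norm'[of 3, unfolded \<open>a2 = 0\<close>] a1']
      by (simp add: c \<open>a2 = 0\<close>)
  qed
  have z: "z i \<noteq> 0" if "i \<in> {1..2}" for i
  proof
    assume "z i = 0"
    then have plane: "d i $ 2 = \<i> * d i $ 3"
      by (simp add: z_def)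
    have i: "i \<in> {1..3}" "i \<noteq> 3"
      using that by auto
    have "d i $ 1 = d 3 $ 1"
      using on_plane(1)[OF i(1) i(1) plane] on_plane(1)[OF three three plane3] by (simp only:)
    moreover from this have "- \<i> * \<Lambda> * d i $ 3 = - \<i> * \<Lambda> * d 3 $ 3"
      using on_plane(2)[of i] on_plane(2)[of 3] plane plane3 i by simp
    then have "d i $ 3 = d 3 $ 3"
      using \<Lambda>0 by simp
    ultimately have "d i = d 3"
      using plane plane3 by (simp add: vec3_eq_iff)
    then show False
      using distinct[of i 3] i by simp
  qed
  have off_plane:
      "d i $ 1 = (1 + \<i>) / 2"
      "3 * a5 * z i^2 + ((1 + \<i>) * a4 - 1) * z i + \<i> / 2 * a2 = 0"
      "(1 + \<i>) * z i * d i $ 3 = (1 + \<i>) / 2 - 3 * a1 * \<i> / 2 - (1 + \<i>) * a2 * z i - a4 * z i^2"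
    if "i \<in> {1..2}" for i
    using grad_potential_fixed_off_plane[OF norm'[of i]] z[OF that] that by (simp_all add: z_def)
  have z12: "z 1 \<noteq> z 2"
  proof
    assume eq: "z 1 = z 2"
    have "(1 + \<i>) * z 1 * d 1 $ 3 = (1 + \<i>) * z 1 * d 2 $ 3"
      using off_plane(3)[of 1] off_plane(3)[of 2] by (simp add: eq del: One_nat_def)
    moreover have "1 + \<i> \<noteq> 0"
      by (simp add: complex_eq_iff)
    ultimately have "d 1 $ 3 = d 2 $ 3"
      using z[of 1] by simp
    moreover have "d 1 $ 1 = d 2 $ 1"
      by (simp only: off_plane(1)[OF m(1)] off_plane(1)[OF m(2)])
    ultimately have "d 1 = d 2"
      using eq by (simp add: vec3_eq_iff z_def)
    then show False
      using distinct[of 1 2] by simp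
  qed

  define r where "r = (1 + \<i>) * a4 - 1"
  define s where "s = \<i> / 2 * a2"
  \<comment> \<open>\<open>P w\<close> is \<open>w^2\<close> times the derivative of the quadratic
    at \<open>w\<close>; \<alpha> is the part of \<Lambda>1 + \<Lambda>2 that is free of z, equal to
    \<open>3 * (1 + \<i>) * a1 - 2\<close>.\<close>
  define P where "P w = w^2 * (2 * (3 * a5) * w + r)" for w
  define \<alpha> where "\<alpha> = - (2 * \<Lambda> / (\<Lambda> + 1))"
  have spec: "\<Lambda>1 i + \<Lambda>2 i = \<alpha> + 2 * a2 * z i" "\<Lambda>1 i * \<Lambda>2 i = - (2 * \<i>) * P (z i)"
    if "i \<in> {1..2}" for i
  proof -
    have i: "i \<in> {1..3}"
      using that by simp
    have eig: "hessian V (d i) *v d i = 2 *s d i"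
      by (simp add: V' hessian_potential_euler norm'[OF i])
    note sp = spectrum_pairD[OF eig nz[OF i] spectra[OF i], unfolded V']
    have "3 * (1 + \<i>) * a1 * (\<Lambda> + 1) = (1 + \<i>) * (3 * a1 * (\<Lambda> + 1))"
      by (simp only: mult_ac)
    also have "\<dots> = 2"
      unfolding cubic_coefficient[OF \<Lambda> a1] by (simp add: algebra_simps)
    also have "2 = (\<alpha> + 2) * (\<Lambda> + 1)"
      using \<Lambda>' by (simp add: \<alpha>_def field_simps)
    finally have "3 * (1 + \<i>) * a1 = \<alpha> + 2"
      using \<Lambda>' by (metis mult_right_cancel)
    then show "\<Lambda>1 i + \<Lambda>2 i = \<alpha> + 2 * a2 * z i"
      using sp(1) trace_hessian_potential_off_plane[OF off_plane(1)[OF that]] by (simp add: z_def)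
    show "\<Lambda>1 i * \<Lambda>2 i = - (2 * \<i>) * P (z i)"
      using sp(2) det_hessian_potential_off_plane[OF off_plane(1)[OF that]]
      by (simp add: P_def r_def z_def algebra_simps)
  qed
  note E = quadratic_roots_power_sums[OF z12 m[THEN z] m[THEN off_plane(2), folded r_def s_def],
      folded P_def]
  have inv: "x / (- (2 * \<i>) * y) = \<i> / 2 * (x / y)" for x y :: complex
    by (cases "y = 0") (simp_all add: field_simps)
  \<comment> \<open>For \<open>a2 = 0\<close> both sides are 0 by the convention
    \<open>x / 0 = 0\<close>, here and in the identities below.\<close>
  have E0: "\<i> / 2 * (1 / P (z 1) + 1 / P (z 2)) = (2 * \<i> + 2 * (1 - \<i>) * a4) / a2^2"
    unfolding E(1) by (cases "a2 = 0") (simp_all add: s_def r_def field_simps power2_eq_square)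
  have E1: "\<i> / 2 * (z 1 / P (z 1) + z 2 / P (z 2)) = - (1 / a2)"
    unfolding E(2) by (cases "a2 = 0") (simp_all add: s_def field_simps)
  have sum2: "(\<Sum>i=1..2. f i) = f 1 + f 2" for f :: "nat \<Rightarrow> complex"
    by (simp add: numeral_2_eq_2)
  define W where "W = 2 * \<i> + 2 * (1 - \<i>) * a4"
  have W: "2 * \<i> + a2^2 + 2 * (1 - \<i>) * a4 = a2^2 + W" "\<i> + a2^2 + (1 - \<i>) * a4 = a2^2 + W / 2"
    by (simp_all add: W_def field_simps)
  have rhs2: "\<alpha> * (W / a2^2) + 2 * a2 * (- (1 / a2))
      = - (2 * (a2^2 + (a2^2 + W) * \<Lambda>) / (a2^2 * (\<Lambda> + 1)))"
    unfolding \<alpha>_def using \<Lambda>'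
    by (cases "a2 = 0"; simp add: divide_simps power2_eq_square; simp add: algebra_simps)
  have rhs3: "\<alpha>^2 * (W / a2^2) + 4 * \<alpha> * a2 * (- (1 / a2)) + 4 * a2^2 * (\<i> / 2 * 0)
      = 8 * \<Lambda> * (a2^2 + (a2^2 + W / 2) * \<Lambda>) / (a2^2 * (1 + \<Lambda>)^2)"
    unfolding \<alpha>_def add.commute[of 1 \<Lambda>] using \<Lambda>'
    by (cases "a2 = 0"; simp add: divide_simps power2_eq_square; simp add: algebra_simps)
  have "(\<Sum>i=1..2. 1 / (\<Lambda>1 i * \<Lambda>2 i)) = \<i> / 2 * (1 / P (z 1) + 1 / P (z 2))"
    by (simp only: sum2 spec[OF m(1)] spec[OF m(2)] inv distrib_left)
  moreover have "(\<Sum>i=1..2. (\<Lambda>1 i + \<Lambda>2 i) / (\<Lambda>1 i * \<Lambda>2 i))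
      = \<alpha> * (\<i> / 2 * (1 / P (z 1) + 1 / P (z 2)))
        + 2 * a2 * (\<i> / 2 * (z 1 / P (z 1) + z 2 / P (z 2)))"
    by (simp only: sum2 spec[OF m(1)] spec[OF m(2)] inv) (simp add: add_divide_distrib algebra_simps)
  \<comment> \<open>Expanding the square of \<open>\<alpha> + 2 * a2 * z\<close> yields the power
    sums for k = 0, 1, 2; the last one vanishes by \<open>E(3)\<close>.\<close>
  moreover have "(\<Sum>i=1..2. (\<Lambda>1 i + \<Lambda>2 i)^2 / (\<Lambda>1 i * \<Lambda>2 i))
      = \<alpha>^2 * (\<i> / 2 * (1 / P (z 1) + 1 / P (z 2)))
        + 4 * \<alpha> * a2 * (\<i> / 2 * (z 1 / P (z 1) + z 2 / P (z 2)))
        + 4 * a2^2 * (\<i> / 2 * (z 1^2 / P (z 1) + z 2^2 / P (z 2)))"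
    by (simp only: sum2 spec[OF m(1)] spec[OF m(2)] inv)
      (simp add: add_divide_distrib power2_eq_square algebra_simps)
  ultimately show ?thesis
    unfolding E0 E1 E(3) W W_def[symmetric] rhs2 rhs3 by blast
qed

end
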